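(* Let $n\ge2$, let $\omega=(\omega_1,\dots,\omega_n)\in[0,1]^n$ satisfy $\sum_{k=1}^n\omega_k=1$, and let $\delta,\varepsilon\in[0,1]$. Then $\mathcal{R}_\delta\subseteq\mathcal{R}_\varepsilon^{\Psi_\omega}$ if and only if $$\delta\le\min\left\{\frac{\varepsilon}{1-\min\{\omega_1,\omega_n\}},\,1\right\}.$$
   Context: The OWA operator $\Psi_\omega:[0,1]^n\to[0,1]$ is $\Psi_\omega(x)=\sum_{k=1}^n\omega_kx_{\sigma(k)}$, where $\sigma$ is a permutation of $\{1,\dots,n\}$ with $x_{\sigma(1)}\ge\dots\ge x_{\sigma(n)}$. For $x\in[0,1]^n$, $\kappa(x)=\max_{1\le i<j\le n}|x_i-x_j|$ and $\kappa^{\Psi_\omega}(x)=\max_{i=1,\dots,n}|x_i-\Psi_\omega(x)|$. The regions are $\mathcal{R}_\delta=\{x\in[0,1]^n:\kappa(x)\le\delta\}$ and $\mathcal{R}_\varepsilon^{\Psi_\omega}=\{x\in[0,1]^n:\kappa^{\Psi_\omega}(x)\le\varepsilon\}$. *)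

theory Defs
  imports Complex_Main "HOL-Library.FuncSet" "HOL-Combinatorics.Permutations"
begin

text \<open>Vectors in \<open>[0,1]\<^sup>n\<close> are extensional functions on the index set \<open>{1..n}\<close>.\<close>

definition unit_cube :: "nat \<Rightarrow> (nat \<Rightarrow> real) set" where
  "unit_cube n = {1..n} \<rightarrow>\<^sub>E {0..1}"

definition sorts_decreasing :: "nat \<Rightarrow> (nat \<Rightarrow> real) \<Rightarrow> (nat \<Rightarrow> nat) \<Rightarrow> bool" where
  "sorts_decreasing n x \<sigma> \<longleftrightarrow> \<sigma> permutes {1..n} \<and> antimono_on {1..n} (x \<circ> \<sigma>)"

text \<open>A sorting permutation always exists, and the value below does not depend on which one
  is chosen; see \<open>sorts_decreasing_exists\<close> and \<open>owa_eq\<close>.\<close>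

definition owa :: "nat \<Rightarrow> (nat \<Rightarrow> real) \<Rightarrow> (nat \<Rightarrow> real) \<Rightarrow> real" where
  "owa n \<omega> x = (let \<sigma> = (SOME \<sigma>. sorts_decreasing n x \<sigma>) in \<Sum>k=1..n. \<omega> k * x (\<sigma> k))"

text \<open>Both maxima below are over nonempty finite sets when \<open>n \<ge> 2\<close>.\<close>

definition kappa :: "nat \<Rightarrow> (nat \<Rightarrow> real) \<Rightarrow> real" where
  "kappa n x = Max {\<bar>x i - x j\<bar> | i j. 1 \<le> i \<and> i < j \<and> j \<le> n}"

definition kappa_agg :: "nat \<Rightarrow> ((nat \<Rightarrow> real) \<Rightarrow> real) \<Rightarrow> (nat \<Rightarrow> real) \<Rightarrow> real" where
  "kappa_agg n \<Psi> x = Max ((\<lambda>i. \<bar>x i - \<Psi> x\<bar>) ` {1..n})"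

definition region :: "nat \<Rightarrow> real \<Rightarrow> (nat \<Rightarrow> real) set" where
  "region n \<delta> = {x \<in> unit_cube n. kappa n x \<le> \<delta>}"

definition region_agg :: "nat \<Rightarrow> ((nat \<Rightarrow> real) \<Rightarrow> real) \<Rightarrow> real \<Rightarrow> (nat \<Rightarrow> real) set" where
  "region_agg n \<Psi> \<epsilon> = {x \<in> unit_cube n. kappa_agg n \<Psi> x \<le> \<epsilon>}"

lemma sorts_decreasing_exists: "\<exists>\<sigma>. sorts_decreasing n x \<sigma>"
proof -
  define xs where "xs = sort_key (\<lambda>i. - x i) [1..<Suc n]"
  have len: "length xs = n" and set: "set xs = {1..n}" and dist: "distinct xs"
    by (auto simp: xs_def)
  have srt: "sorted (map (\<lambda>i. - x i) xs)"
    by (simp add: xs_def)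
  define \<sigma> where "\<sigma> = (\<lambda>k. if k \<in> {1..n} then xs ! (k - 1) else k)"
  have "inj_on \<sigma> {1..n}"
    using dist by (auto simp: \<sigma>_def inj_on_def nth_eq_iff_index_eq len)
  moreover have "\<sigma> ` {1..n} \<subseteq> {1..n}"
  proof
    fix y assume "y \<in> \<sigma> ` {1..n}"
    then obtain k where "k \<in> {1..n}" "y = xs ! (k - 1)"
      by (auto simp: \<sigma>_def)
    then have "y \<in> set xs"
      using len by (auto intro!: nth_mem)
    then show "y \<in> {1..n}"
      by (simp only: set)
  qed
  ultimately have "bij_betw \<sigma> {1..n} {1..n}"
    by (simp add: bij_betw_def endo_inj_surj)
  then have "\<sigma> permutes {1..n}"
    by (rule bij_imp_permutes) (unfold \<sigma>_def, rule if_not_P)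
  moreover have "antimono_on {1..n} (x \<circ> \<sigma>)"
  proof (rule monotone_onI)
    fix i j assume "i \<in> {1..n}" "j \<in> {1..n}" "i \<le> j"
    then show "(x \<circ> \<sigma>) j \<le> (x \<circ> \<sigma>) i"
      using sorted_nth_mono[OF srt, of "i - 1" "j - 1"] len by (auto simp: \<sigma>_def)
  qed
  ultimately show ?thesis
    unfolding sorts_decreasing_def by blast
qed

lemma sorts_decreasing_unique:
  assumes "sorts_decreasing n x \<sigma>" "sorts_decreasing n x \<tau>" "k \<in> {1..n}"
  shows "x (\<sigma> k) = x (\<tau> k)"
proof -
  let ?L = "\<lambda>\<rho>. map (\<lambda>k. - x (\<rho> k)) [1..<Suc n]"
  have srt: "sorted (?L \<rho>)" if "sorts_decreasing n x \<rho>" for \<rho>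
    using that
    by (auto simp: sorts_decreasing_def monotone_on_def sorted_iff_nth_mono simp del: upt_Suc)
  have ms: "mset (?L \<rho>) = image_mset (\<lambda>i. - x i) (mset_set {1..n})"
    if "sorts_decreasing n x \<rho>" for \<rho>
  proof -
    have p: "\<rho> permutes {1..n}" using that by (simp add: sorts_decreasing_def)
    have "mset [1..<Suc n] = mset_set {1..n}"
      by (simp add: atLeastLessThanSuc_atLeastAtMost flip: mset_set_set del: upt_Suc)
    then have "mset (?L \<rho>) = image_mset (\<lambda>i. - x i) (image_mset \<rho> (mset_set {1..n}))"
      by (simp add: multiset.map_comp comp_def del: upt_Suc)
    also have "image_mset \<rho> (mset_set {1..n}) = mset_set {1..n}"
      using p by (simp add: image_mset_mset_set permutes_inj_on permutes_image)
    finally show ?thesis .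
  qed
  have "?L \<sigma> = ?L \<tau>"
    using properties_for_sort[OF trans[OF ms[OF assms(2)] ms[OF assms(1), symmetric]] srt[OF assms(2)]]
      properties_for_sort[OF refl srt[OF assms(1)]] by (rule trans[OF sym, rotated])
  then show ?thesis
    using assms(3) by (auto simp: map_eq_conv simp del: upt_Suc)
qed

lemma owa_eq:
  assumes "sorts_decreasing n x \<sigma>"
  shows "owa n \<omega> x = (\<Sum>k=1..n. \<omega> k * x (\<sigma> k))"
proof -
  have "sorts_decreasing n x (SOME \<sigma>. sorts_decreasing n x \<sigma>)"
    using assms by (rule someI[where P = "sorts_decreasing n x"])
  from sorts_decreasing_unique[OF this assms] show ?thesis
    unfolding owa_def Let_def by (intro sum.cong) auto
qed

end

theory Submission imports Defs
begin

text \<open>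
  The maximal deviation of the entries of \<open>x\<close> from \<open>\<Psi> = owa n \<omega> x\<close> is at most
  \<open>(1 - min (\<omega> 1) (\<omega> n)) * kappa n x\<close>, and this factor is sharp for every spread; the theorem
  is this fact solved for \<open>\<delta>\<close>.

  For the bound, only the largest and the smallest entry of \<open>x\<close> matter. The largest entry is one
  of the averaged values, with weight \<open>\<omega> 1\<close>; that share of the average contributes nothing to its
  distance from \<open>\<Psi>\<close>, and the remaining weight \<open>1 - \<omega> 1\<close> sits on entries at distance at most the
  spread (\<open>weighted_mean_deviation\<close>). The smallest entry has weight \<open>\<omega> n\<close> and behaves in the same
  way.

  The estimate at one end is an equality when all entries other than the extreme one lie at the
  opposite end of the range. Such vectors take only the values \<open>\<delta>\<close> and
  \<open>0\<close>, with either a single \<open>\<delta>\<close> or a single \<open>0\<close> (\<open>step_vector\<close>).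

  The final division by \<open>1 - min (\<omega> 1) (\<omega> n)\<close> is legitimate because \<open>\<omega> 1\<close> and \<open>\<omega> n\<close>
  are weights of two different positions when \<open>n \<ge> 2\<close>, so that the smaller one is at most \<open>1/2\<close>.
\<close>

lemma kappa_le_iff:
  assumes "n \<ge> 2"
  shows "kappa n x \<le> d \<longleftrightarrow> (\<forall>i\<in>{1..n}. \<forall>j\<in>{1..n}. \<bar>x i - x j\<bar> \<le> d)"
proof -
  let ?S = "{\<bar>x i - x j\<bar> | i j. 1 \<le> i \<and> i < j \<and> j \<le> n}"
  have "?S \<subseteq> (\<lambda>(i, j). \<bar>x i - x j\<bar>) ` ({1..n} \<times> {1..n})"
    by force
  then have fin: "finite ?S"
    by (rule finite_subset) simp
  have pair: "\<bar>x 1 - x 2\<bar> \<in> ?S"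
    using assms by force
  have le_iff: "kappa n x \<le> d \<longleftrightarrow> (\<forall>i j. 1 \<le> i \<and> i < j \<and> j \<le> n \<longrightarrow> \<bar>x i - x j\<bar> \<le> d)"
    unfolding kappa_def using fin pair by (subst Max_le_iff) (blast+)
  show ?thesis
  proof
    assume le: "kappa n x \<le> d"
    show "\<forall>i\<in>{1..n}. \<forall>j\<in>{1..n}. \<bar>x i - x j\<bar> \<le> d"
    proof (intro ballI)
      fix i j assume ij: "i \<in> {1..n}" "j \<in> {1..n}"
      \<comment> \<open>On the diagonal the claim is \<open>0 \<le> d\<close>, which holds because some off-diagonal pair exists.\<close>
      have "\<bar>x 1 - x 2\<bar> \<le> d"
        using le assms le_iff by simp
      then have "0 \<le> d"
        using abs_ge_zero[of "x 1 - x 2"] by linarith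
      moreover have "i < j \<Longrightarrow> \<bar>x i - x j\<bar> \<le> d" "j < i \<Longrightarrow> \<bar>x j - x i\<bar> \<le> d"
        using ij le le_iff by auto
      ultimately show "\<bar>x i - x j\<bar> \<le> d"
        using abs_minus_commute[of "x i" "x j"] by (cases i j rule: linorder_cases) simp_all
    qed
  qed (use le_iff in auto)
qed

lemma kappa_agg_le_iff:
  assumes "n \<ge> 1"
  shows "kappa_agg n \<Psi> x \<le> e \<longleftrightarrow> (\<forall>i\<in>{1..n}. \<bar>x i - \<Psi> x\<bar> \<le> e)"
  unfolding kappa_agg_def using assms by (subst Max_le_iff) auto

text \<open>
  Since the weights sum to 1, the difference is the weighted mean of the numbers \<open>z i - z k\<close>, and
  the term \<open>k = i\<close> vanishes.
\<close>

lemma weighted_mean_deviation: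
  fixes w z :: "'a \<Rightarrow> real"
  assumes "finite A" "i \<in> A"
    and nonneg: "\<And>k. k \<in> A \<Longrightarrow> 0 \<le> w k"
    and total: "sum w A = 1"
    and le: "\<And>k. k \<in> A \<Longrightarrow> z i - z k \<le> d"
  shows "z i - (\<Sum>k\<in>A. w k * z k) \<le> (1 - w i) * d"
proof -
  have "z i - (\<Sum>k\<in>A. w k * z k) = (\<Sum>k\<in>A. w k * (z i - z k))"
    using total by (simp add: right_diff_distrib sum_subtractf flip: sum_distrib_right)
  also have "\<dots> = (\<Sum>k\<in>A - {i}. w k * (z i - z k))"
    using assms(1,2) by (simp add: sum.remove)
  also have "\<dots> \<le> (\<Sum>k\<in>A - {i}. w k * d)"
    by (intro sum_mono mult_left_mono) (auto intro: nonneg le)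
  also have "\<dots> = (1 - w i) * d"
    using assms(1,2) total by (simp add: sum_diff1 flip: sum_distrib_right)
  finally show ?thesis .
qed

lemma owa_deviation_le:
  fixes x :: "nat \<Rightarrow> real"
  assumes n: "n \<ge> 2"
    and nonneg: "\<And>k. k \<in> {1..n} \<Longrightarrow> 0 \<le> \<omega> k"
    and total: "(\<Sum>k=1..n. \<omega> k) = 1"
    and spread: "\<And>i j. i \<in> {1..n} \<Longrightarrow> j \<in> {1..n} \<Longrightarrow> \<bar>x i - x j\<bar> \<le> d"
    and i: "i \<in> {1..n}"
  shows "\<bar>x i - owa n \<omega> x\<bar> \<le> (1 - min (\<omega> 1) (\<omega> n)) * d"
proof -
  obtain \<sigma> where \<sigma>: "sorts_decreasing n x \<sigma>"
    using sorts_decreasing_exists by blast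
  then have perm: "\<sigma> permutes {1..n}" and anti: "antimono_on {1..n} (x \<circ> \<sigma>)"
    by (simp_all add: sorts_decreasing_def)
  obtain k where k: "k \<in> {1..n}" "i = \<sigma> k"
    using permutes_image[OF perm] i by blast
  have top: "x i \<le> x (\<sigma> 1)" and bottom: "x (\<sigma> n) \<le> x i"
    using anti k n by (auto simp: monotone_on_def)
  have gap: "x (\<sigma> j) - x (\<sigma> l) \<le> d" if "j \<in> {1..n}" "l \<in> {1..n}" for j l
    using spread[of "\<sigma> j" "\<sigma> l"] that permutes_in_image[OF perm] by (simp add: abs_le_iff)
  have "0 \<le> d"
    using spread[OF i i] by simp
  then have weaken: "(1 - \<omega> 1) * d \<le> (1 - min (\<omega> 1) (\<omega> n)) * d"
      "(1 - \<omega> n) * d \<le> (1 - min (\<omega> 1) (\<omega> n)) * d"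
    by (auto intro!: mult_right_mono)
  have "x (\<sigma> 1) - owa n \<omega> x \<le> (1 - \<omega> 1) * d"
    unfolding owa_eq[OF \<sigma>]
    using n gap nonneg total by (intro weighted_mean_deviation[where z = "\<lambda>k. x (\<sigma> k)"]) auto
  moreover have "owa n \<omega> x - x (\<sigma> n) \<le> (1 - \<omega> n) * d"
    \<comment> \<open>The lower end is the upper end of the negated values.\<close>
    using weighted_mean_deviation[of "{1..n}" n \<omega> "\<lambda>k. - x (\<sigma> k)" d] n gap nonneg total
    by (simp add: owa_eq[OF \<sigma>] sum_negf)
  ultimately show ?thesis
    using top bottom weaken by (simp add: abs_le_iff)
qed

text \<open>
  These vectors are already listed in decreasing order, so their OWA value is a partial sum of the
  weights.
\<close>

definition step_vector :: "nat \<Rightarrow> nat \<Rightarrow> real \<Rightarrow> nat \<Rightarrow> real" where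
  "step_vector n m d = (\<lambda>i\<in>{1..n}. if i \<le> m then d else 0)"

lemma step_vector_in_region:
  assumes "n \<ge> 2" "d \<in> {0..1}"
  shows "step_vector n m d \<in> region n d"
  using assms by (auto simp: region_def unit_cube_def kappa_le_iff step_vector_def)

lemma owa_step_vector:
  assumes "m \<le> n" "0 \<le> d"
  shows "owa n \<omega> (step_vector n m d) = d * (\<Sum>k=1..m. \<omega> k)"
proof -
  have "sorts_decreasing n (step_vector n m d) id"
    using assms by (auto simp: sorts_decreasing_def monotone_on_def step_vector_def permutes_id)
  then have "owa n \<omega> (step_vector n m d) = (\<Sum>k=1..n. \<omega> k * step_vector n m d (id k))"
    by (rule owa_eq)
  also have "\<dots> = (\<Sum>k=1..m. \<omega> k * d)"
    using assms(1) by (intro sum.mono_neutral_cong_right) (auto simp: step_vector_def)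
  finally show ?thesis
    by (simp add: sum_distrib_left mult.commute)
qed

theorem theorem5:
  fixes n :: nat and \<omega> :: "nat \<Rightarrow> real" and \<delta> \<epsilon> :: real
  assumes "n \<ge> 2"
    and "\<omega> \<in> unit_cube n"
    and "(\<Sum>k=1..n. \<omega> k) = 1"
    and "\<delta> \<in> {0..1}"
    and "\<epsilon> \<in> {0..1}"
  shows "region n \<delta> \<subseteq> region_agg n (owa n \<omega>) \<epsilon> \<longleftrightarrow>
         \<delta> \<le> min (\<epsilon> / (1 - min (\<omega> 1) (\<omega> n))) 1"
proof -
  let ?c = "1 - min (\<omega> 1) (\<omega> n)"
  have nonneg: "0 \<le> \<omega> k" if "k \<in> {1..n}" for k
    using assms(2) that by (auto simp: unit_cube_def PiE_iff)
  have "(\<Sum>k\<in>{1, n}. \<omega> k) \<le> (\<Sum>k=1..n. \<omega> k)"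
    using assms(1) by (intro sum_mono2) (auto intro: nonneg)
  then have "\<omega> 1 + \<omega> n \<le> 1"
    using assms(1,3) by simp
  then have "0 < ?c"
    by (simp add: min_def)
  then have rhs: "\<delta> \<le> min (\<epsilon> / ?c) 1 \<longleftrightarrow> ?c * \<delta> \<le> \<epsilon>"
    using assms(4) by (simp add: pos_le_divide_eq mult.commute)
  have "region n \<delta> \<subseteq> region_agg n (owa n \<omega>) \<epsilon> \<longleftrightarrow> ?c * \<delta> \<le> \<epsilon>"
  proof
    assume sub: "region n \<delta> \<subseteq> region_agg n (owa n \<omega>) \<epsilon>"
    have dev: "\<bar>step_vector n m \<delta> i - \<delta> * (\<Sum>k=1..m. \<omega> k)\<bar> \<le> \<epsilon>" if "m \<le> n" "i \<in> {1..n}" for m i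
    proof -
      have "step_vector n m \<delta> \<in> region_agg n (owa n \<omega>) \<epsilon>"
        using sub step_vector_in_region assms(1,4) by blast
      then show ?thesis
        using that assms(1,4) by (simp add: region_agg_def kappa_agg_le_iff owa_step_vector)
    qed
    have "(1 - \<omega> 1) * \<delta> \<le> \<epsilon>"
      using dev[of 1 1] assms(1) by (simp add: step_vector_def algebra_simps)
    moreover have "(1 - \<omega> n) * \<delta> \<le> \<epsilon>"
    proof -
      have "(\<Sum>k=1..n. \<omega> k) = (\<Sum>k=1..n-1. \<omega> k) + \<omega> n"
        using assms(1) by (cases n) auto
      then have "(\<Sum>k=1..n-1. \<omega> k) = 1 - \<omega> n"
        using assms(3) by simp
      then show ?thesis
        using dev[of "n - 1" n] assms(1)
        by (auto simp: step_vector_def abs_le_iff mult.commute split: if_splits)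
    qed
    ultimately show "?c * \<delta> \<le> \<epsilon>"
      by (simp add: min_def)
  next
    assume le: "?c * \<delta> \<le> \<epsilon>"
    show "region n \<delta> \<subseteq> region_agg n (owa n \<omega>) \<epsilon>"
    proof
      fix x assume x: "x \<in> region n \<delta>"
      then have "\<bar>x i - x j\<bar> \<le> \<delta>" if "i \<in> {1..n}" "j \<in> {1..n}" for i j
        using that assms(1) by (simp add: region_def kappa_le_iff)
      then have "\<bar>x i - owa n \<omega> x\<bar> \<le> ?c * \<delta>" if "i \<in> {1..n}" for i
        using owa_deviation_le[of n \<omega> x \<delta> i] nonneg assms(1,3) that by blast
      then have "\<bar>x i - owa n \<omega> x\<bar> \<le> \<epsilon>" if "i \<in> {1..n}" for i
        using le that by (meson order_trans)
      then show "x \<in> region_agg n (owa n \<omega>) \<epsilon>"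
        using x assms(1) by (simp add: region_def region_agg_def kappa_agg_le_iff)
    qed
  qed
  then show ?thesis
    unfolding rhs .
qed

end
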